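(* Let $\mathrm C(\mathbb Z)$ be the category of complexes of abelian groups and $\mathbb I(\mathbb Z)\subset\mathrm C(\mathbb Z)$ the full subcategory of h-injective complexes with injective components. There is no pair $(\mathbf i,\iota)$ where $\mathbf i\colon\mathrm C(\mathbb Z)\to\mathbb I(\mathbb Z)$ is an additive functor and $\iota\colon\mathrm{id}\to\mathbf i$ is a natural transformation of functors such that for each $M\in\mathrm C(\mathbb Z)$ the morphism $\iota_M\colon M\to\mathbf i(M)$ is a quasi-isomorphism. In particular, the injective model structure on $\mathrm C(\mathbb Z)$ does not admit $\mathrm C(\mathbb Z)$-enriched functorial factorizations, and there is no $\mathrm C(\mathbb Z)$-enriched fibrant replacement functor.
   Context: A complex $I$ is h-injective if every chain map from an acyclic complex to $I$ is nullhomotopic. The injective model structure on $\mathrm C(\mathbb Z)$ has quasi-isomorphisms as weak equivalences and monomorphisms as cofibrations; its fibrant objects are exactly the objects of $\mathbb I(\mathbb Z)$, and its fibrations are the epimorphisms with kernel in $\mathbb I(\mathbb Z)$. Let $\underline{\mathrm C}(\mathbb Z)$ be the dg category of complexes of abelian groups, i.e. $\mathrm C(\mathbb Z)$ enriched over itself. For a dg category $\mathcal M$, $\mathcal M^{[1]}$ is the dg category whose objects are closed degree zero morphisms $f\colon A\to B$ and whose morphism complex from $f$ to $f'\colon A'\to B'$ consists of pairs $(a,b)\in\mathcal M(A,A')\times\mathcal M(B,B')$ with $bf=f'a$; $\mathcal M^{[2]}$ (two composable arrows) is defined similarly. A $\mathrm C(\mathbb Z)$-enriched functorial factorization is a dg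 functor $\mathcal M^{[1]}\to\mathcal M^{[2]}$ that is a section of the composition functor. The model structure admits enriched functorial factorizations if there are two of them, factoring every $f$ as a cofibration followed by a trivial fibration, respectively as a trivial cofibration followed by a fibration. An enriched fibrant replacement functor is a dg functor $\mathbf{fib}\colon\underline{\mathrm C}(\mathbb Z)\to\underline{\mathrm C}(\mathbb Z)$ for which there is a dg natural transformation $\phi\colon\mathrm{id}\to\mathbf{fib}$ such that every $\mathbf{fib}(M)$ is fibrant and every $\phi_M$ is a trivial cofibration. *)

theory Defs
  imports "HOL-Algebra.Product_Groups"
begin

section \<open>Universes and homomorphisms of abelian groups\<close>

text \<open>
  HOL has no type of all abelian groups, so the category of abelian groups is taken relative to
  a universe \<open>U\<close>: a collection of subsets of the type \<open>'u\<close>, the sets that are allowed as carriers.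
  Only two closure properties are asked for; the sets belonging to a Grothendieck universe that
  contains an infinite set have them, and so does the collection of all subsets of an infinite
  type. All objects, including the test objects in the definitions of injective and h-injective,
  range over the same \<open>U\<close>.

  Abelian groups are the commutative groups of HOL-Algebra, written multiplicatively.
\<close>

definition universe :: "'u set set \<Rightarrow> bool" where
  "universe U \<longleftrightarrow> (\<exists>V\<in>U. infinite V) \<and> (\<forall>V\<in>U. \<forall>W. W \<subseteq> V \<longrightarrow> W \<in> U)"

definition abelian_groups :: "'u set set \<Rightarrow> 'u monoid set" where
  "abelian_groups U = {G. comm_group G \<and> carrier G \<in> U}"

text \<open>Morphisms are extensional, so that equality of morphisms is equality of HOL functions.\<close>

definition ext_hom :: "'a monoid \<Rightarrow> 'b monoid \<Rightarrow> ('a \<Rightarrow> 'b) set" where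
  "ext_hom G H = hom G H \<inter> extensional (carrier G)"

definition hom_group :: "'a monoid \<Rightarrow> 'b monoid \<Rightarrow> ('a \<Rightarrow> 'b) monoid" where
  "hom_group G H = \<lparr>carrier = ext_hom G H,
                    monoid.mult = (\<lambda>f g. \<lambda>x\<in>carrier G. f x \<otimes>\<^bsub>H\<^esub> g x),
                    one = (\<lambda>x\<in>carrier G. \<one>\<^bsub>H\<^esub>)\<rparr>"

definition injective_group :: "'u set set \<Rightarrow> 'u monoid \<Rightarrow> bool" where
  "injective_group U J \<longleftrightarrow> J \<in> abelian_groups U \<and>
     (\<forall>G\<in>abelian_groups U. \<forall>H\<in>abelian_groups U. \<forall>m\<in>mon G H. \<forall>f\<in>hom G J.
        \<exists>g\<in>hom H J. \<forall>x\<in>carrier G. g (m x) = f x)"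


section \<open>Complexes\<close>

record 'a cpx =
  grp :: "int \<Rightarrow> 'a monoid"
  diff :: "int \<Rightarrow> 'a \<Rightarrow> 'a"

definition is_complex :: "'a cpx \<Rightarrow> bool" where
  "is_complex A \<longleftrightarrow>
     (\<forall>n. comm_group (grp A n)) \<and>
     (\<forall>n. diff A n \<in> ext_hom (grp A n) (grp A (n + 1))) \<and>
     (\<forall>n. \<forall>x\<in>carrier (grp A n). diff A (n + 1) (diff A n x) = \<one>\<^bsub>grp A (n + 1 + 1)\<^esub>)"

definition complexes :: "'u set set \<Rightarrow> 'u cpx set" where
  "complexes U = {A. is_complex A \<and> (\<forall>n. carrier (grp A n) \<in> U)}"

definition chain_maps :: "'a cpx \<Rightarrow> 'b cpx \<Rightarrow> (int \<Rightarrow> 'a \<Rightarrow> 'b) set" where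
  "chain_maps A B = {f. (\<forall>n. f n \<in> ext_hom (grp A n) (grp B n)) \<and>
     (\<forall>n. \<forall>x\<in>carrier (grp A n). diff B n (f n x) = f (n + 1) (diff A n x))}"

definition chain_id :: "'a cpx \<Rightarrow> int \<Rightarrow> 'a \<Rightarrow> 'a" where
  "chain_id A = (\<lambda>n. \<lambda>x\<in>carrier (grp A n). x)"

definition chain_comp ::
    "'a cpx \<Rightarrow> (int \<Rightarrow> 'b \<Rightarrow> 'c) \<Rightarrow> (int \<Rightarrow> 'a \<Rightarrow> 'b) \<Rightarrow> int \<Rightarrow> 'a \<Rightarrow> 'c" where
  "chain_comp A g f = (\<lambda>n. compose (carrier (grp A n)) (g n) (f n))"

definition chain_add ::
    "'a cpx \<Rightarrow> 'b cpx \<Rightarrow> (int \<Rightarrow> 'a \<Rightarrow> 'b) \<Rightarrow> (int \<Rightarrow> 'a \<Rightarrow> 'b) \<Rightarrow> int \<Rightarrow> 'a \<Rightarrow> 'b" where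
  "chain_add A B f g = (\<lambda>n. \<lambda>x\<in>carrier (grp A n). f n x \<otimes>\<^bsub>grp B n\<^esub> g n x)"

definition cocycles :: "'a cpx \<Rightarrow> int \<Rightarrow> 'a monoid" where
  "cocycles A n = (grp A n)\<lparr>carrier := kernel (grp A n) (grp A (n + 1)) (diff A n)\<rparr>"

definition coboundaries :: "'a cpx \<Rightarrow> int \<Rightarrow> 'a set" where
  "coboundaries A n = diff A (n - 1) ` carrier (grp A (n - 1))"

definition cohomology :: "'a cpx \<Rightarrow> int \<Rightarrow> 'a set monoid" where
  "cohomology A n = cocycles A n Mod coboundaries A n"

text \<open>The class of a cocycle \<open>x\<close> is sent to the class of \<open>f n x\<close>; the union is over equal cosets.\<close>

definition cohomology_map ::
    "'a cpx \<Rightarrow> 'b cpx \<Rightarrow> (int \<Rightarrow> 'a \<Rightarrow> 'b) \<Rightarrow> int \<Rightarrow> 'a set \<Rightarrow> 'b set" where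
  "cohomology_map A B f n c = (\<Union>x\<in>c. coboundaries B n #>\<^bsub>cocycles B n\<^esub> f n x)"

definition quasi_iso :: "'a cpx \<Rightarrow> 'b cpx \<Rightarrow> (int \<Rightarrow> 'a \<Rightarrow> 'b) \<Rightarrow> bool" where
  "quasi_iso A B f \<longleftrightarrow> f \<in> chain_maps A B \<and>
     (\<forall>n. cohomology_map A B f n \<in> iso (cohomology A n) (cohomology B n))"

definition acyclic_cpx :: "'a cpx \<Rightarrow> bool" where
  "acyclic_cpx A \<longleftrightarrow> (\<forall>n. trivial_group (cohomology A n))"

definition nullhomotopic :: "'a cpx \<Rightarrow> 'b cpx \<Rightarrow> (int \<Rightarrow> 'a \<Rightarrow> 'b) \<Rightarrow> bool" where
  "nullhomotopic A B f \<longleftrightarrow>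
     (\<exists>s. (\<forall>n. s n \<in> hom (grp A n) (grp B (n - 1))) \<and>
          (\<forall>n. \<forall>x\<in>carrier (grp A n).
             f n x = diff B (n - 1) (s n x) \<otimes>\<^bsub>grp B n\<^esub> s (n + 1) (diff A n x)))"

definition h_injective :: "'u set set \<Rightarrow> 'u cpx \<Rightarrow> bool" where
  "h_injective U J \<longleftrightarrow>
     (\<forall>A\<in>complexes U. acyclic_cpx A \<longrightarrow> (\<forall>f\<in>chain_maps A J. nullhomotopic A J f))"

definition h_injectives :: "'u set set \<Rightarrow> 'u cpx set" where
  "h_injectives U = {J \<in> complexes U. h_injective U J \<and> (\<forall>n. injective_group U (grp J n))}"


section \<open>Additive functors into h-injective complexes\<close>

definition additive_functor_on_complexes ::
    "'u set set \<Rightarrow> 'u cpx set \<Rightarrow> ('u cpx \<Rightarrow> 'u cpx)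
     \<Rightarrow> ('u cpx \<Rightarrow> 'u cpx \<Rightarrow> (int \<Rightarrow> 'u \<Rightarrow> 'u) \<Rightarrow> (int \<Rightarrow> 'u \<Rightarrow> 'u)) \<Rightarrow> bool" where
  "additive_functor_on_complexes U D Fo Fm \<longleftrightarrow>
     (\<forall>A\<in>complexes U. Fo A \<in> D) \<and>
     (\<forall>A\<in>complexes U. \<forall>B\<in>complexes U. \<forall>f\<in>chain_maps A B.
        Fm A B f \<in> chain_maps (Fo A) (Fo B)) \<and>
     (\<forall>A\<in>complexes U. Fm A A (chain_id A) = chain_id (Fo A)) \<and>
     (\<forall>A\<in>complexes U. \<forall>B\<in>complexes U. \<forall>C\<in>complexes U.
        \<forall>f\<in>chain_maps A B. \<forall>g\<in>chain_maps B C.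
        Fm A C (chain_comp A g f) = chain_comp (Fo A) (Fm B C g) (Fm A B f)) \<and>
     (\<forall>A\<in>complexes U. \<forall>B\<in>complexes U. \<forall>f\<in>chain_maps A B. \<forall>g\<in>chain_maps A B.
        Fm A B (chain_add A B f g) = chain_add (Fo A) (Fo B) (Fm A B f) (Fm A B g))"

definition natural_from_id ::
    "'u set set \<Rightarrow> ('u cpx \<Rightarrow> 'u cpx)
     \<Rightarrow> ('u cpx \<Rightarrow> 'u cpx \<Rightarrow> (int \<Rightarrow> 'u \<Rightarrow> 'u) \<Rightarrow> (int \<Rightarrow> 'u \<Rightarrow> 'u))
     \<Rightarrow> ('u cpx \<Rightarrow> int \<Rightarrow> 'u \<Rightarrow> 'u) \<Rightarrow> bool" where
  "natural_from_id U Fo Fm \<iota> \<longleftrightarrow>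
     (\<forall>A\<in>complexes U. \<iota> A \<in> chain_maps A (Fo A)) \<and>
     (\<forall>A\<in>complexes U. \<forall>B\<in>complexes U. \<forall>f\<in>chain_maps A B.
        chain_comp A (\<iota> B) f = chain_comp A (Fm A B f) (\<iota> A))"


section \<open>The injective model structure\<close>

text \<open>
  Weak equivalences are the quasi-isomorphisms and cofibrations the monomorphisms; fibrations are
  taken in their explicit form (epimorphisms with kernel in \<open>h_injectives U\<close>) instead of by lifting.
\<close>

definition monomorphism :: "'a cpx \<Rightarrow> 'b cpx \<Rightarrow> (int \<Rightarrow> 'a \<Rightarrow> 'b) \<Rightarrow> bool" where
  "monomorphism A B f \<longleftrightarrow> f \<in> chain_maps A B \<and> (\<forall>n. f n \<in> mon (grp A n) (grp B n))"

definition epimorphism :: "'a cpx \<Rightarrow> 'b cpx \<Rightarrow> (int \<Rightarrow> 'a \<Rightarrow> 'b) \<Rightarrow> bool" where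
  "epimorphism A B f \<longleftrightarrow> f \<in> chain_maps A B \<and> (\<forall>n. f n \<in> epi (grp A n) (grp B n))"

definition kernel_cpx :: "'a cpx \<Rightarrow> 'b cpx \<Rightarrow> (int \<Rightarrow> 'a \<Rightarrow> 'b) \<Rightarrow> 'a cpx" where
  "kernel_cpx A B f =
     \<lparr>grp = (\<lambda>n. (grp A n)\<lparr>carrier := kernel (grp A n) (grp B n) (f n)\<rparr>),
      diff = (\<lambda>n. restrict (diff A n) (kernel (grp A n) (grp B n) (f n)))\<rparr>"

definition fibration :: "'u set set \<Rightarrow> 'u cpx \<Rightarrow> 'u cpx \<Rightarrow> (int \<Rightarrow> 'u \<Rightarrow> 'u) \<Rightarrow> bool" where
  "fibration U A B f \<longleftrightarrow> epimorphism A B f \<and> kernel_cpx A B f \<in> h_injectives U"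

definition zero_cpx :: "'a cpx \<Rightarrow> bool" where
  "zero_cpx Z \<longleftrightarrow> (\<forall>n. trivial_group (grp Z n))"

definition fibrant :: "'u set set \<Rightarrow> 'u cpx \<Rightarrow> bool" where
  "fibrant U X \<longleftrightarrow> X \<in> complexes U \<and>
     (\<forall>Z\<in>complexes U. zero_cpx Z \<longrightarrow> (\<forall>f\<in>chain_maps X Z. fibration U X Z f))"


section \<open>Dg categories, dg functors, and factorizations\<close>

text \<open>
  \<open>cmp M X Y Z m n g f\<close> is the composite of \<open>g\<close>, of degree \<open>m\<close> from \<open>Y\<close> to \<open>Z\<close>, with \<open>f\<close>, of
  degree \<open>n\<close> from \<open>X\<close> to \<open>Y\<close>. The degrees are explicit because one HOL value may be an element
  of a morphism complex in several degrees.
\<close>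

record ('o, 'm) dgcat =
  obj :: "'o set"
  mor :: "'o \<Rightarrow> 'o \<Rightarrow> 'm cpx"
  cmp :: "'o \<Rightarrow> 'o \<Rightarrow> 'o \<Rightarrow> int \<Rightarrow> int \<Rightarrow> 'm \<Rightarrow> 'm \<Rightarrow> 'm"
  ident :: "'o \<Rightarrow> 'm"

abbreviation mor_deg :: "('o, 'm) dgcat \<Rightarrow> 'o \<Rightarrow> 'o \<Rightarrow> int \<Rightarrow> 'm set" where
  "mor_deg M X Y n \<equiv> carrier (grp (mor M X Y) n)"

definition closed0 :: "('o, 'm) dgcat \<Rightarrow> 'o \<Rightarrow> 'o \<Rightarrow> 'm set" where
  "closed0 M X Y = {f \<in> mor_deg M X Y 0. diff (mor M X Y) 0 f = \<one>\<^bsub>grp (mor M X Y) 1\<^esub>}"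

record ('o, 'm, 'p, 'n) dgfun =
  fobj :: "'o \<Rightarrow> 'p"
  fmor :: "'o \<Rightarrow> 'o \<Rightarrow> int \<Rightarrow> 'm \<Rightarrow> 'n"

definition dg_functor ::
    "('o, 'm) dgcat \<Rightarrow> ('p, 'n) dgcat \<Rightarrow> ('o, 'm, 'p, 'n) dgfun \<Rightarrow> bool" where
  "dg_functor M N F \<longleftrightarrow>
     (\<forall>X\<in>obj M. fobj F X \<in> obj N) \<and>
     (\<forall>X\<in>obj M. \<forall>Y\<in>obj M.
        fmor F X Y \<in> chain_maps (mor M X Y) (mor N (fobj F X) (fobj F Y))) \<and>
     (\<forall>X\<in>obj M. fmor F X X 0 (ident M X) = ident N (fobj F X)) \<and>
     (\<forall>X\<in>obj M. \<forall>Y\<in>obj M. \<forall>Z\<in>obj M. \<forall>m n.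
        \<forall>g\<in>mor_deg M Y Z m. \<forall>f\<in>mor_deg M X Y n.
        fmor F X Z (m + n) (cmp M X Y Z m n g f)
        = cmp N (fobj F X) (fobj F Y) (fobj F Z) m n (fmor F Y Z m g) (fmor F X Y n f))"

definition dg_id :: "('o, 'm) dgcat \<Rightarrow> ('o, 'm, 'o, 'm) dgfun" where
  "dg_id M = \<lparr>fobj = (\<lambda>X. X), fmor = (\<lambda>X Y. chain_id (mor M X Y))\<rparr>"

definition dg_nat_trans ::
    "('o, 'm) dgcat \<Rightarrow> ('p, 'n) dgcat \<Rightarrow> ('o, 'm, 'p, 'n) dgfun \<Rightarrow> ('o, 'm, 'p, 'n) dgfun
     \<Rightarrow> ('o \<Rightarrow> 'n) \<Rightarrow> bool" where
  "dg_nat_trans M N F G \<phi> \<longleftrightarrow>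
     (\<forall>X\<in>obj M. \<phi> X \<in> closed0 N (fobj F X) (fobj G X)) \<and>
     (\<forall>X\<in>obj M. \<forall>Y\<in>obj M. \<forall>n. \<forall>f\<in>mor_deg M X Y n.
        cmp N (fobj F X) (fobj F Y) (fobj G Y) 0 n (\<phi> Y) (fmor F X Y n f)
        = cmp N (fobj F X) (fobj G X) (fobj G Y) n 0 (fmor G X Y n f) (\<phi> X))"

text \<open>The dg categories of arrows and of composable pairs of arrows.\<close>

definition arrow1 :: "('o, 'm) dgcat \<Rightarrow> ('o \<times> 'o \<times> 'm, 'm \<times> 'm) dgcat" where
  "arrow1 M =
     \<lparr>obj = {(A, B, f). A \<in> obj M \<and> B \<in> obj M \<and> f \<in> closed0 M A B},
      mor = (\<lambda>(A, B, f) (A', B', f').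
        let E = (\<lambda>n. {(a, b). a \<in> mor_deg M A A' n \<and> b \<in> mor_deg M B B' n \<and>
                   cmp M A B B' n 0 b f = cmp M A A' B' 0 n f' a}) in
        \<lparr>grp = (\<lambda>n. (grp (mor M A A') n \<times>\<times> grp (mor M B B') n)\<lparr>carrier := E n\<rparr>),
         diff = (\<lambda>n. \<lambda>(a, b)\<in>E n. (diff (mor M A A') n a, diff (mor M B B') n b))\<rparr>),
      cmp = (\<lambda>(A, B, f) (A', B', f') (A'', B'', f'') m n (a', b') (a, b).
        (cmp M A A' A'' m n a' a, cmp M B B' B'' m n b' b)),
      ident = (\<lambda>(A, B, f). (ident M A, ident M B))\<rparr>"

definition arrow2 ::
    "('o, 'm) dgcat \<Rightarrow> ('o \<times> 'o \<times> 'o \<times> 'm \<times> 'm, 'm \<times> 'm \<times> 'm) dgcat" where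
  "arrow2 M =
     \<lparr>obj = {(A, X, B, f, g). A \<in> obj M \<and> X \<in> obj M \<and> B \<in> obj M \<and>
               f \<in> closed0 M A X \<and> g \<in> closed0 M X B},
      mor = (\<lambda>(A, X, B, f, g) (A', X', B', f', g').
        let E = (\<lambda>n. {(a, x, b). a \<in> mor_deg M A A' n \<and> x \<in> mor_deg M X X' n \<and>
                   b \<in> mor_deg M B B' n \<and>
                   cmp M A X X' n 0 x f = cmp M A A' X' 0 n f' a \<and>
                   cmp M X B B' n 0 b g = cmp M X X' B' 0 n g' x}) in
        \<lparr>grp = (\<lambda>n. (grp (mor M A A') n \<times>\<times> grp (mor M X X') n \<times>\<times> grp (mor M B B') n)
                  \<lparr>carrier := E n\<rparr>),
         diff = (\<lambda>n. \<lambda>(a, x, b)\<in>E n.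
           (diff (mor M A A') n a, diff (mor M X X') n x, diff (mor M B B') n b))\<rparr>),
      cmp = (\<lambda>(A, X, B, f, g) (A', X', B', f', g') (A'', X'', B'', f'', g'') m n
               (a', x', b') (a, x, b).
        (cmp M A A' A'' m n a' a, cmp M X X' X'' m n x' x, cmp M B B' B'' m n b' b)),
      ident = (\<lambda>(A, X, B, f, g). (ident M A, ident M X, ident M B))\<rparr>"

definition composition_functor ::
    "('o, 'm) dgcat
     \<Rightarrow> ('o \<times> 'o \<times> 'o \<times> 'm \<times> 'm, 'm \<times> 'm \<times> 'm, 'o \<times> 'o \<times> 'm, 'm \<times> 'm) dgfun" where
  "composition_functor M =
     \<lparr>fobj = (\<lambda>(A, X, B, f, g). (A, B, cmp M A X B 0 0 g f)),
      fmor = (\<lambda>P Q n. \<lambda>(a, x, b)\<in>mor_deg (arrow2 M) P Q n. (a, b))\<rparr>"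

definition enriched_functorial_factorization ::
    "('o, 'm) dgcat
     \<Rightarrow> ('o \<times> 'o \<times> 'm, 'm \<times> 'm, 'o \<times> 'o \<times> 'o \<times> 'm \<times> 'm, 'm \<times> 'm \<times> 'm) dgfun \<Rightarrow> bool" where
  "enriched_functorial_factorization M F \<longleftrightarrow>
     dg_functor (arrow1 M) (arrow2 M) F \<and>
     (\<forall>P\<in>obj (arrow1 M). fobj (composition_functor M) (fobj F P) = P) \<and>
     (\<forall>P\<in>obj (arrow1 M). \<forall>Q\<in>obj (arrow1 M). \<forall>n. \<forall>c\<in>mor_deg (arrow1 M) P Q n.
        fmor (composition_functor M) (fobj F P) (fobj F Q) n (fmor F P Q n c) = c)"

text \<open>\<open>L\<close> and \<open>R\<close> are the classes prescribed for the two factors.\<close>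

definition factors_through ::
    "('o, 'm) dgcat
     \<Rightarrow> ('o \<times> 'o \<times> 'm, 'm \<times> 'm, 'o \<times> 'o \<times> 'o \<times> 'm \<times> 'm, 'm \<times> 'm \<times> 'm) dgfun
     \<Rightarrow> ('o \<Rightarrow> 'o \<Rightarrow> 'm \<Rightarrow> bool) \<Rightarrow> ('o \<Rightarrow> 'o \<Rightarrow> 'm \<Rightarrow> bool) \<Rightarrow> bool" where
  "factors_through M F L R \<longleftrightarrow>
     (\<forall>P\<in>obj (arrow1 M). case fobj F P of (A, X, B, f, g) \<Rightarrow> L A X f \<and> R X B g)"

definition admits_enriched_functorial_factorizations ::
    "('o, 'm) dgcat \<Rightarrow> ('o \<Rightarrow> 'o \<Rightarrow> 'm \<Rightarrow> bool) \<Rightarrow> ('o \<Rightarrow> 'o \<Rightarrow> 'm \<Rightarrow> bool)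
     \<Rightarrow> ('o \<Rightarrow> 'o \<Rightarrow> 'm \<Rightarrow> bool) \<Rightarrow> bool" where
  "admits_enriched_functorial_factorizations M weq cof fib \<longleftrightarrow>
     (\<exists>F. enriched_functorial_factorization M F \<and>
          factors_through M F cof (\<lambda>X Y f. fib X Y f \<and> weq X Y f)) \<and>
     (\<exists>F. enriched_functorial_factorization M F \<and>
          factors_through M F (\<lambda>X Y f. cof X Y f \<and> weq X Y f) fib)"


section \<open>The dg category of complexes\<close>

text \<open>
  An element of degree \<open>n\<close> is a family of homomorphisms \<open>f p\<close> from degree \<open>p\<close> to degree \<open>p + n\<close>,
  and \<open>d f = d \<circ> f - (-1)^n f \<circ> d\<close>; the exponent \<open>\<plusminus>1\<close> below is \<open>-(-1)^n\<close> in multiplicative notation.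
\<close>

definition hom_cpx :: "'a cpx \<Rightarrow> 'b cpx \<Rightarrow> (int \<Rightarrow> 'a \<Rightarrow> 'b) cpx" where
  "hom_cpx A B =
     \<lparr>grp = (\<lambda>n. product_group UNIV (\<lambda>p. hom_group (grp A p) (grp B (p + n)))),
      diff = (\<lambda>n. \<lambda>f\<in>carrier (product_group UNIV (\<lambda>p. hom_group (grp A p) (grp B (p + n)))).
        \<lambda>p. \<lambda>x\<in>carrier (grp A p).
          diff B (p + n) (f p x) \<otimes>\<^bsub>grp B (p + n + 1)\<^esub>
          (f (p + 1) (diff A p x) [^]\<^bsub>grp B (p + n + 1)\<^esub> (if even n then - 1 else 1 :: int)))\<rparr>"

definition dg_complexes :: "'u set set \<Rightarrow> ('u cpx, int \<Rightarrow> 'u \<Rightarrow> 'u) dgcat" where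
  "dg_complexes U =
     \<lparr>obj = complexes U,
      mor = hom_cpx,
      cmp = (\<lambda>A B C m n g f. \<lambda>p. compose (carrier (grp A p)) (g (p + n)) (f p)),
      ident = chain_id\<rparr>"

definition enriched_fibrant_replacement ::
    "'u set set
     \<Rightarrow> ('u cpx, int \<Rightarrow> 'u \<Rightarrow> 'u, 'u cpx, int \<Rightarrow> 'u \<Rightarrow> 'u) dgfun \<Rightarrow> bool" where
  "enriched_fibrant_replacement U F \<longleftrightarrow>
     dg_functor (dg_complexes U) (dg_complexes U) F \<and>
     (\<exists>\<phi>. dg_nat_trans (dg_complexes U) (dg_complexes U) (dg_id (dg_complexes U)) F \<phi> \<and>
        (\<forall>M\<in>complexes U. fibrant U (fobj F M) \<and>
           monomorphism M (fobj F M) (\<phi> M) \<and> quasi_iso M (fobj F M) (\<phi> M)))"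

end

theory Submission
  imports Defs
begin

text \<open>
  Let \<open>M\<close> be \<open>\<int>/2\<close> placed in degree 0. Its identity satisfies \<open>id = id + id + id\<close>, and so does the
  identity of the image of \<open>M\<close> under every additive or enriched functor; hence this image is
  annihilated by 2. An injective group annihilated by 2 is zero, since a homomorphism from
  \<open>\<int>/2\<close> extends along \<open>2: \<int>/2 \<rightarrow> \<int>/4\<close>. So the image of \<open>M\<close> is the zero complex, which
  is not quasi-isomorphic to \<open>M\<close>. The enriched statements follow in the same way, from the
  factorization of \<open>M \<rightarrow> 0\<close> and from the fibrant replacement of \<open>M\<close>.
\<close>

section \<open>Cyclic groups in a universe\<close>

text \<open>The group \<int>/n with the residue \<open>i\<close> coded as \<open>e i\<close>, since
  carriers must be sets over \<open>'u\<close>. It is used for injective \<open>e\<close> and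
  positive \<open>n\<close>.\<close>

definition cyclic_on :: "(nat \<Rightarrow> 'u) \<Rightarrow> nat \<Rightarrow> 'u monoid" where
  "cyclic_on e n = \<lparr>carrier = e ` {..<n},
                    monoid.mult = (\<lambda>x y. e ((inv_into UNIV e x + inv_into UNIV e y) mod n)),
                    one = e 0\<rparr>"

lemma carrier_cyclic_on [simp]: "carrier (cyclic_on e n) = e ` {..<n}"
  by (simp add: cyclic_on_def)

lemma one_cyclic_on [simp]: "\<one>\<^bsub>cyclic_on e n\<^esub> = e 0"
  by (simp add: cyclic_on_def)

lemma mult_cyclic_on [simp]:
  "inj e \<Longrightarrow> e i \<otimes>\<^bsub>cyclic_on e n\<^esub> e j = e ((i + j) mod n)"
  by (simp add: cyclic_on_def)

lemma comm_group_cyclic_on: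
  assumes "inj e" "0 < n"
  shows "comm_group (cyclic_on e n)"
proof (rule comm_groupI)
  fix x assume "x \<in> carrier (cyclic_on e n)"
  then obtain i where i: "x = e i" "i < n" by auto
  \<comment> \<open>The inverse is reduced mod \<open>n\<close> because \<open>i = 0\<close> would
    otherwise give \<open>e n\<close>, which is outside the carrier.\<close>
  have "e ((n - i) mod n) \<otimes>\<^bsub>cyclic_on e n\<^esub> x = \<one>\<^bsub>cyclic_on e n\<^esub>"
    using i assms by (simp add: mod_simps)
  then show "\<exists>y\<in>carrier (cyclic_on e n). y \<otimes>\<^bsub>cyclic_on e n\<^esub> x = \<one>\<^bsub>cyclic_on e n\<^esub>"
    using assms by (intro bexI) auto
qed (use assms in \<open>auto simp: mod_simps ac_simps\<close>)

text \<open>An infinite member of \<open>U\<close> contains a copy of the naturals, and all its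
  subsets are in \<open>U\<close>. One \<open>e\<close> thus provides carriers for all the cyclic
  groups at once.\<close>

lemma universe_embedding:
  fixes U :: "'u set set"
  assumes "universe U"
  obtains e :: "nat \<Rightarrow> 'u" where "inj e" "\<And>I. e ` I \<in> U"
proof -
  obtain V where V: "V \<in> U" "infinite V" and sub: "\<And>W. W \<subseteq> V \<Longrightarrow> W \<in> U"
    using assms unfolding universe_def by blast
  obtain e :: "nat \<Rightarrow> 'u" where "inj e" "range e \<subseteq> V"
    using V(2) infinite_countable_subset by blast
  then show thesis by (intro that[of e] sub) auto
qed

lemma injective_group_of_exponent_two_trivial:
  fixes U :: "'u set set"
  assumes "universe U" and J: "injective_group U J"
    and two: "\<And>x. x \<in> carrier J \<Longrightarrow> x \<otimes>\<^bsub>J\<^esub> x = \<one>\<^bsub>J\<^esub>"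
    and x: "x \<in> carrier J"
  shows "x = \<one>\<^bsub>J\<^esub>"
proof -
  obtain e :: "nat \<Rightarrow> 'u" where e: "inj e" "\<And>I. e ` I \<in> U"
    using universe_embedding[OF \<open>universe U\<close>] by blast
  \<comment> \<open>\<open>?m\<close> is the doubling embedding of \<int>/2 into \<int>/4, and
    \<open>?f\<close> sends the generator \<open>e 1\<close> of \<int>/2 to
    \<open>x\<close>.\<close>
  let ?m = "\<lambda>y. e (2 * inv_into UNIV e y)" and ?f = "\<lambda>y. if y = e 0 then \<one>\<^bsub>J\<^esub> else x"
  interpret J: comm_group J using J by (simp add: injective_group_def abelian_groups_def)
  have less2: "{..<2::nat} = {0, 1}" by auto
  have ab: "cyclic_on e n \<in> abelian_groups U" if "0 < n" for n
    using comm_group_cyclic_on[OF e(1) that] e(2) by (simp add: abelian_groups_def)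
  have m: "?m \<in> mon (cyclic_on e 2) (cyclic_on e 4)"
    using e(1) by (auto simp: mon_def hom_def less2 inj_eq)
  have f: "?f \<in> hom (cyclic_on e 2) J"
    using e(1) x two[OF x] by (auto simp: hom_def less2 inj_eq)
  obtain g where g: "g \<in> hom (cyclic_on e 4) J"
      "\<And>y. y \<in> carrier (cyclic_on e 2) \<Longrightarrow> g (?m y) = ?f y"
    using J[unfolded injective_group_def, THEN conjunct2, rule_format,
        OF ab[OF zero_less_numeral] ab[OF zero_less_numeral] m f] by blast
  have e1: "e 1 \<in> carrier (cyclic_on e 4)" by auto
  \<comment> \<open>The sum of \<open>e 1\<close> with itself in \<int>/4 is \<open>e 2\<close>, the
    image of the generator under \<open>?m\<close>. Hence \<open>x\<close> is the square of
    \<open>g (e 1)\<close>, and squares in \<open>J\<close> are trivial.\<close>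
  have "x = g (e 1 \<otimes>\<^bsub>cyclic_on e 4\<^esub> e 1)"
    using g(2)[of "e 1"] e(1) by (simp add: inj_eq less2 numeral_2_eq_2)
  also have "\<dots> = \<one>\<^bsub>J\<^esub>"
    using hom_mult[OF g(1) e1 e1] two hom_in_carrier[OF g(1) e1] by simp
  finally show ?thesis .
qed

section \<open>Complexes with zero differential\<close>

definition zero_diff_cpx :: "(int \<Rightarrow> 'a monoid) \<Rightarrow> 'a cpx" where
  "zero_diff_cpx G = \<lparr>grp = G, diff = (\<lambda>n. \<lambda>x\<in>carrier (G n). \<one>\<^bsub>G (n + 1)\<^esub>)\<rparr>"

definition zero_map :: "'a cpx \<Rightarrow> 'b cpx \<Rightarrow> int \<Rightarrow> 'a \<Rightarrow> 'b" where
  "zero_map A B = (\<lambda>n. \<lambda>x\<in>carrier (grp A n). \<one>\<^bsub>grp B n\<^esub>)"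

lemma grp_zero_diff_cpx [simp]: "grp (zero_diff_cpx G) = G"
  by (simp add: zero_diff_cpx_def)

lemma is_complex_zero_diff_cpx:
  assumes "\<And>n. comm_group (G n)"
  shows "is_complex (zero_diff_cpx G)"
proof -
  have grp: "group (G n)" for n using assms comm_group.axioms(2) by blast
  have one: "\<one>\<^bsub>G n\<^esub> \<in> carrier (G n)" for n using group.is_monoid[OF grp] by (rule monoid.one_closed)
  have "\<one>\<^bsub>G n\<^esub> \<otimes>\<^bsub>G n\<^esub> \<one>\<^bsub>G n\<^esub> = \<one>\<^bsub>G n\<^esub>" for n
    using monoid.l_one[OF group.is_monoid[OF grp] one] .
  then show ?thesis using assms one monoid.m_closed[OF group.is_monoid[OF grp]]
    by (auto simp: is_complex_def zero_diff_cpx_def ext_hom_def hom_def)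
qed

lemma is_complexD:
  assumes "is_complex A"
  shows "comm_group (grp A n)" "group (grp A n)"
    and "diff A n \<in> hom (grp A n) (grp A (n + 1))"
  using assms comm_group.axioms(2) by (auto simp: is_complex_def ext_hom_def)

lemma is_complex_diff:
  assumes "is_complex A"
  shows "x \<in> carrier (grp A n) \<Longrightarrow> diff A n x \<in> carrier (grp A (n + 1))"
    and "diff A n \<one>\<^bsub>grp A n\<^esub> = \<one>\<^bsub>grp A (n + 1)\<^esub>"
  using is_complexD[OF assms] hom_in_carrier hom_one by metis+

lemma zero_map_ext_hom:
  assumes "is_complex A" "is_complex B"
  shows "zero_map A B n \<in> ext_hom (grp A n) (grp B n)"
proof -
  interpret A: group "grp A n" by (rule is_complexD[OF assms(1)])
  interpret B: group "grp B n" by (rule is_complexD[OF assms(2)])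
  show ?thesis by (auto simp: zero_map_def ext_hom_def hom_def)
qed

lemma zero_map_chain_maps:
  assumes "is_complex A" "is_complex B"
  shows "zero_map A B \<in> chain_maps A B"
  using zero_map_ext_hom[OF assms] is_complex_diff[OF assms(1)] is_complex_diff[OF assms(2)]
  by (auto simp: chain_maps_def zero_map_def)

lemma chain_id_ext_hom:
  assumes "is_complex A"
  shows "chain_id A n \<in> ext_hom (grp A n) (grp A n)"
proof -
  interpret A: group "grp A n" by (rule is_complexD[OF assms(1)])
  show ?thesis by (auto simp: chain_id_def ext_hom_def hom_def)
qed

lemma chain_id_chain_maps:
  assumes "is_complex A"
  shows "chain_id A \<in> chain_maps A A"
  using chain_id_ext_hom[OF assms] is_complex_diff[OF assms]
  by (auto simp: chain_maps_def chain_id_def)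

text \<open>The product runs over all of \<open>UNIV\<close> and \<open>p + 0 = p\<close>, so
  arbitrary families of homomorphisms remain. Chain maps are the closed ones among them.\<close>

lemma mor_deg_0_dg_complexes:
  "mor_deg (dg_complexes U) A B 0 = {f. \<forall>n. f n \<in> ext_hom (grp A n) (grp B n)}"
  by (auto simp: dg_complexes_def hom_cpx_def hom_group_def)

text \<open>Identifies the group law in degree 0 with the addition of chain maps, so that additive
  functors and dg functors lead to the same equation for identities.\<close>

lemma mult_0_dg_complexes:
  "f \<otimes>\<^bsub>grp (mor (dg_complexes U) A B) 0\<^esub> g = chain_add A B f g"
  by (simp add: dg_complexes_def hom_cpx_def hom_group_def chain_add_def fun_eq_iff)

lemma ident_dg_complexes [simp]: "ident (dg_complexes U) = chain_id"
  by (simp add: dg_complexes_def)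

lemma obj_dg_complexes [simp]: "obj (dg_complexes U) = complexes U"
  by (simp add: dg_complexes_def)

text \<open>Makes the map from \<open>M\<close> to a zero complex an object of the arrow category,
  to which a factorization applies.\<close>

lemma zero_map_closed0:
  assumes "is_complex A" "is_complex B"
  shows "zero_map A B \<in> closed0 (dg_complexes U) A B"
proof -
  have "zero_map A B \<in> mor_deg (dg_complexes U) A B 0"
    using zero_map_ext_hom[OF assms] by (auto simp: mor_deg_0_dg_complexes)
  moreover have "diff (mor (dg_complexes U) A B) 0 (zero_map A B)
      = \<one>\<^bsub>grp (mor (dg_complexes U) A B) 1\<^esub>"
    using calculation is_complex_diff[OF assms(1)] is_complex_diff[OF assms(2)]
      group.is_monoid[OF is_complexD(2)[OF assms(2)]] is_complexD(2)[OF assms(2)]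
    by (auto simp: dg_complexes_def hom_cpx_def hom_group_def zero_map_def fun_eq_iff
        group.int_pow_one)
  ultimately show ?thesis by (simp add: closed0_def)
qed

section \<open>Identities that equal three times themselves\<close>

text \<open>The relation is written as a cube, without neutral elements, so that multiplicativity of
  \<open>h\<close> suffices. It can then be applied to the morphism complexes of
  \<open>arrow1\<close> and \<open>arrow2\<close> without first proving that these consist of
  groups.\<close>

lemma hom_cube:
  assumes "h \<in> hom G H" "x \<in> carrier G" "x \<otimes>\<^bsub>G\<^esub> x \<in> carrier G"
    and "x \<otimes>\<^bsub>G\<^esub> (x \<otimes>\<^bsub>G\<^esub> x) = x"
  shows "h x \<otimes>\<^bsub>H\<^esub> (h x \<otimes>\<^bsub>H\<^esub> h x) = h x"
  using assms hom_mult by metis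

lemma chain_add_id_id:
  assumes "\<And>n x. x \<in> carrier (grp M n) \<Longrightarrow> x \<otimes>\<^bsub>grp M n\<^esub> x = \<one>\<^bsub>grp M n\<^esub>"
  shows "chain_add M M (chain_id M) (chain_id M) = zero_map M M"
  using assms by (auto simp: chain_add_def chain_id_def zero_map_def fun_eq_iff)

lemma chain_add_id_zero:
  assumes "is_complex M"
  shows "chain_add M M (chain_id M) (zero_map M M) = chain_id M"
proof -
  have "monoid (grp M n)" for n using is_complexD(2)[OF assms] group.is_monoid by blast
  then show ?thesis
    by (auto simp: chain_add_def chain_id_def zero_map_def fun_eq_iff monoid.r_one)
qed

text \<open>Evaluate the equation of endomorphisms at \<open>x\<close> and cancel one factor
  \<open>x\<close>.\<close>

lemma exponent_two_if_cube_id: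
  assumes "is_complex J"
    and "chain_add J J (chain_id J) (chain_add J J (chain_id J) (chain_id J)) = chain_id J"
    and x: "x \<in> carrier (grp J n)"
  shows "x \<otimes>\<^bsub>grp J n\<^esub> x = \<one>\<^bsub>grp J n\<^esub>"
proof -
  interpret J: group "grp J n" by (rule is_complexD[OF assms(1)])
  have "x \<otimes>\<^bsub>grp J n\<^esub> (x \<otimes>\<^bsub>grp J n\<^esub> x) = x"
    using fun_cong[OF fun_cong[OF assms(2), of n], of x] x by (simp add: chain_add_def chain_id_def)
  then show ?thesis using x by simp
qed

text \<open>With at most one element in degree \<open>n\<close>, \<open>J\<close> has at most one
  cohomology class there. Injectivity on cohomology then identifies the class of \<open>x\<close>
  with that of the neutral element.\<close>

lemma quasi_iso_into_trivial:
  assumes "quasi_iso M J f" and M: "is_complex M"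
    and "carrier (grp J n) \<subseteq> {z}"
    and "x \<in> carrier (cocycles M n)"
  shows "x \<in> coboundaries M n"
proof -
  interpret G: group "grp M n" by (rule is_complexD[OF M])
  interpret G': group "grp M (n - 1)" by (rule is_complexD[OF M])
  have d: "diff M (n - 1) \<in> hom (grp M (n - 1)) (grp M n)"
    using is_complexD(3)[OF M, of "n - 1"] by simp
  have one_b: "\<one>\<^bsub>grp M n\<^esub> \<in> coboundaries M n"
    unfolding coboundaries_def
    using hom_one[OF d G'.group_axioms G.group_axioms] by (metis G'.one_closed imageI)
  have b_carrier: "coboundaries M n \<subseteq> carrier (grp M n)"
    using d by (auto simp: coboundaries_def hom_in_carrier)
  let ?c = "\<lambda>y. coboundaries M n #>\<^bsub>cocycles M n\<^esub> y"
  have one_z: "\<one>\<^bsub>grp M n\<^esub> \<in> carrier (cocycles M n)"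
    using hom_one[OF is_complexD(3)[OF M, of n] G.group_axioms is_complexD(2)[OF M]]
    by (simp add: cocycles_def kernel_def)
  have trivial: "c = c'" if "c \<in> carrier (cohomology J n)" "c' \<in> carrier (cohomology J n)" for c c'
    using that assms(3)
    by (auto simp: cohomology_def FactGroup_def RCOSETS_def cocycles_def kernel_def)
  have inj: "inj_on (cohomology_map M J f n) (carrier (cohomology M n))"
    and maps: "cohomology_map M J f n \<in> carrier (cohomology M n) \<rightarrow> carrier (cohomology J n)"
    using assms(1) by (auto simp: quasi_iso_def iso_def bij_betw_def)
  have "?c y \<in> carrier (cohomology M n)" if "y \<in> carrier (cocycles M n)" for y
    using that by (auto simp: cohomology_def FactGroup_def RCOSETS_def)
  then have "?c x = ?c \<one>\<^bsub>grp M n\<^esub>"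
    using inj maps trivial assms(4) one_z by (meson Pi_mem inj_onD)
  moreover have "x \<in> ?c x"
    using one_b assms(4) by (force simp: r_coset_def cocycles_def kernel_def)
  moreover have "?c \<one>\<^bsub>grp M n\<^esub> = coboundaries M n"
    using b_carrier by (force simp: r_coset_def cocycles_def)
  ultimately show ?thesis by simp
qed

text \<open>The group \<int>/2 concentrated in degree 0; \<open>cyclic_on e 1\<close> is the trivial
  group on \<open>e 0\<close>.\<close>

definition Z2_cpx :: "(nat \<Rightarrow> 'u) \<Rightarrow> 'u cpx" where
  "Z2_cpx e = zero_diff_cpx (\<lambda>n. cyclic_on e (if n = 0 then 2 else 1))"

lemma is_complex_Z2_cpx: "inj e \<Longrightarrow> is_complex (Z2_cpx e)"
  unfolding Z2_cpx_def by (rule is_complex_zero_diff_cpx) (simp add: comm_group_cyclic_on)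

lemma Z2_cpx_exponent_two:
  assumes "inj e" "x \<in> carrier (grp (Z2_cpx e) n)"
  shows "x \<otimes>\<^bsub>grp (Z2_cpx e) n\<^esub> x = \<one>\<^bsub>grp (Z2_cpx e) n\<^esub>"
  using assms by (auto simp: Z2_cpx_def mult_2[symmetric])

lemma Z2_cpx_cube_id:
  assumes "inj e" and M: "M = Z2_cpx e"
  shows "chain_add M M (chain_id M) (chain_add M M (chain_id M) (chain_id M)) = chain_id M"
  using is_complex_Z2_cpx[OF assms(1)] Z2_cpx_exponent_two[OF assms(1)]
  unfolding M by (simp add: chain_add_id_id chain_add_id_zero)

text \<open>The common end of all three claims. The cube equation and injectivity make
  \<open>J\<close> trivial in degree 0, whereas \<open>e 1\<close> is a cocycle and the only
  coboundary in that degree is \<open>e 0\<close>.\<close>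

lemma no_quasi_iso_Z2_cpx:
  assumes "universe U" "inj e" and J: "is_complex J" "\<And>n. injective_group U (grp J n)"
    and "chain_add J J (chain_id J) (chain_add J J (chain_id J) (chain_id J)) = chain_id J"
  shows "\<not> quasi_iso (Z2_cpx e) J f"
proof
  assume q: "quasi_iso (Z2_cpx e) J f"
  have "carrier (grp J 0) \<subseteq> {\<one>\<^bsub>grp J 0\<^esub>}"
    using injective_group_of_exponent_two_trivial[OF assms(1) J(2)]
      exponent_two_if_cube_id[OF J(1) assms(5)] by blast
  moreover have "e 1 \<in> carrier (cocycles (Z2_cpx e) 0)"
    by (auto simp: cocycles_def kernel_def Z2_cpx_def zero_diff_cpx_def)
  ultimately have "e 1 \<in> coboundaries (Z2_cpx e) 0"
    using quasi_iso_into_trivial[OF q is_complex_Z2_cpx[OF assms(2)]] by blast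
  then show False
    using assms(2) by (auto simp: coboundaries_def Z2_cpx_def zero_diff_cpx_def inj_eq)
qed

section \<open>Enriched functors\<close>

text \<open>The kernel of a map to zero is everything, so the components of the kernel complex are
  literally those of \<open>X\<close>. This serves both the middle object of a factorization and a
  fibrant replacement.\<close>

lemma injective_if_fibration_to_zero:
  assumes "fibration U X Z g" "is_complex Z" "zero_cpx Z"
  shows "injective_group U (grp X n)"
proof -
  have "g n \<in> hom (grp X n) (grp Z n)"
    using assms(1) by (auto simp: fibration_def epimorphism_def epi_def)
  then have "kernel (grp X n) (grp Z n) (g n) = carrier (grp X n)"
    using assms(3) by (fastforce simp: zero_cpx_def trivial_group_def kernel_def hom_def)
  then have "grp (kernel_cpx X Z g) n = grp X n"
    by (simp add: kernel_cpx_def)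
  then show ?thesis
    using assms(1) by (auto simp: fibration_def h_injectives_def dest!: spec[of _ n])
qed

lemma chain_id_arrow1:
  assumes "is_complex A" "is_complex B" "f \<in> mor_deg (dg_complexes U) A B 0"
  shows "(chain_id A, chain_id B) \<in> mor_deg (arrow1 (dg_complexes U)) (A, B, f) (A, B, f) 0"
  using assms chain_id_ext_hom[OF assms(1)] chain_id_ext_hom[OF assms(2)]
  by (auto simp: arrow1_def mor_deg_0_dg_complexes)
     (auto simp: dg_complexes_def chain_id_def fun_eq_iff compose_def ext_hom_def hom_def
       extensional_def)

text \<open>For components of exponent two this pair is the sum of the identity with itself, which
  \<open>hom_cube\<close> requires to be a morphism of degree 0. The square commutes because
  \<open>f\<close> preserves neutral elements.\<close>

lemma zero_map_arrow1:
  assumes "is_complex A" "is_complex B" "f \<in> mor_deg (dg_complexes U) A B 0"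
  shows "(zero_map A A, zero_map B B) \<in> mor_deg (arrow1 (dg_complexes U)) (A, B, f) (A, B, f) 0"
proof -
  have f: "f n \<in> hom (grp A n) (grp B n)" for n
    using assms(3) by (auto simp: mor_deg_0_dg_complexes ext_hom_def)
  have "compose (carrier (grp A n)) (zero_map B B n) (f n)
      = compose (carrier (grp A n)) (f n) (zero_map A A n)" for n
    using hom_one[OF f is_complexD(2)[OF assms(1)] is_complexD(2)[OF assms(2)]] hom_in_carrier[OF f]
    by (auto simp: compose_def zero_map_def fun_eq_iff)
  then have "cmp (dg_complexes U) A B B 0 0 (zero_map B B) f
      = cmp (dg_complexes U) A A B 0 0 f (zero_map A A)"
    by (simp add: dg_complexes_def)
  then show ?thesis
    using zero_map_ext_hom[OF assms(1,1)] zero_map_ext_hom[OF assms(2,2)]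
    by (simp add: arrow1_def mor_deg_0_dg_complexes)
qed

lemma chain_id_cube_mor_deg_0:
  assumes "is_complex M" "\<And>n x. x \<in> carrier (grp M n) \<Longrightarrow> x \<otimes>\<^bsub>grp M n\<^esub> x = \<one>\<^bsub>grp M n\<^esub>"
  shows "chain_id M \<in> mor_deg (dg_complexes U) M M 0"
    and "chain_add M M (chain_id M) (chain_id M) \<in> mor_deg (dg_complexes U) M M 0"
  using chain_id_ext_hom[OF assms(1)] zero_map_ext_hom[OF assms(1,1)]
  by (simp_all add: mor_deg_0_dg_complexes chain_add_id_id assms(2))

lemma mult_arrow1_0:
  "(a, b) \<otimes>\<^bsub>grp (mor (arrow1 (dg_complexes U)) (A, B, f) (A', B', f')) 0\<^esub> (a', b')
    = (chain_add A A' a a', chain_add B B' b b')"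
  by (simp add: arrow1_def mult_0_dg_complexes)

lemma mult_arrow2_0:
  "(a, x, b) \<otimes>\<^bsub>grp (mor (arrow2 (dg_complexes U)) (A, X, B, f, g) (A', X', B', f', g')) 0\<^esub>
     (a', x', b')
    = (chain_add A A' a a', chain_add X X' x x', chain_add B B' b b')"
  by (simp add: arrow2_def mult_0_dg_complexes)

theorem lemma4p4:
  fixes U :: "'u set set"
  assumes "universe U"
  shows "(\<nexists>i_obj i_mor \<iota>.
            additive_functor_on_complexes U (h_injectives U) i_obj i_mor \<and>
            natural_from_id U i_obj i_mor \<iota> \<and>
            (\<forall>M\<in>complexes U. quasi_iso M (i_obj M) (\<iota> M))) \<and>
         \<not> admits_enriched_functorial_factorizations
             (dg_complexes U) quasi_iso monomorphism (fibration U) \<and>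
         (\<nexists>fib. enriched_fibrant_replacement U fib)"
proof -
  obtain e :: "nat \<Rightarrow> 'u" where e: "inj e" "\<And>I. e ` I \<in> U"
    using universe_embedding[OF assms] by blast
  define M where "M = Z2_cpx e"
  \<comment> \<open>A zero complex inside \<open>U\<close>: the target of the arrow to be factored,
    and the test object for fibrancy.\<close>
  define Z where "Z = zero_diff_cpx (\<lambda>n::int. cyclic_on e 1)"
  note cM = is_complex_Z2_cpx[OF e(1), folded M_def]
  have cZ: "is_complex Z"
    unfolding Z_def by (rule is_complex_zero_diff_cpx) (simp add: comm_group_cyclic_on e(1))
  have zZ: "zero_cpx Z"
    using is_complexD(2)[OF cZ] by (simp add: zero_cpx_def trivial_group_def Z_def lessThan_Suc)
  have M: "M \<in> complexes U" and Z: "Z \<in> complexes U"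
    using cM cZ e(2) by (simp_all add: complexes_def M_def Z2_cpx_def Z_def)
  note two = Z2_cpx_exponent_two[OF e(1), folded M_def]
  note cube = Z2_cpx_cube_id[OF e(1) M_def]
  note no_qi = no_quasi_iso_Z2_cpx[OF assms e(1), folded M_def]
  have two_Z: "x \<otimes>\<^bsub>grp Z n\<^esub> x = \<one>\<^bsub>grp Z n\<^esub>" if "x \<in> carrier (grp Z n)" for x n
    using that e(1) by (auto simp: Z_def)
  have False if "additive_functor_on_complexes U (h_injectives U) Fo Fm"
      and q: "\<forall>A\<in>complexes U. quasi_iso A (Fo A) (\<iota> A)" for Fo Fm \<iota>
  proof -
    let ?i = "chain_id M"
    \<comment> \<open>The sum of the identity with itself is the zero map, since \<open>M\<close>
      has exponent two; hence it is a chain map.\<close>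
    have i: "?i \<in> chain_maps M M" "chain_add M M ?i ?i \<in> chain_maps M M"
      using chain_id_chain_maps[OF cM] zero_map_chain_maps[OF cM cM]
      by (simp_all add: chain_add_id_id two)
    have F: "Fo M \<in> h_injectives U" "Fm M M ?i = chain_id (Fo M)"
        and add: "\<And>f g. f \<in> chain_maps M M \<Longrightarrow> g \<in> chain_maps M M \<Longrightarrow>
          Fm M M (chain_add M M f g) = chain_add (Fo M) (Fo M) (Fm M M f) (Fm M M g)"
      using that(1) M unfolding additive_functor_on_complexes_def by blast+
    show False
    proof (rule no_qi[THEN notE, OF _ _ _ bspec[OF q M]])
      show "is_complex (Fo M)" "injective_group U (grp (Fo M) n)" for n
        using F(1) by (auto simp: h_injectives_def complexes_def)
      show "chain_add (Fo M) (Fo M) (chain_id (Fo M))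
          (chain_add (Fo M) (Fo M) (chain_id (Fo M)) (chain_id (Fo M))) = chain_id (Fo M)"
        using add[OF i] add[OF i(1) i(1)] F(2) cube by simp
    qed
  qed
  \<comment> \<open>The factorization into a trivial cofibration and a fibration is refuted at the
    arrow from \<open>M\<close> to \<open>Z\<close>.\<close>
  moreover have False if "enriched_functorial_factorization (dg_complexes U) F"
      and fac: "factors_through (dg_complexes U) F
        (\<lambda>X Y f. monomorphism X Y f \<and> quasi_iso X Y f) (fibration U)" for F
  proof -
    let ?P = "(M, Z, zero_map M Z)"
    let ?ii = "(chain_id M, chain_id Z)"
    have z: "zero_map M Z \<in> closed0 (dg_complexes U) M Z" by (rule zero_map_closed0[OF cM cZ])
    have P: "?P \<in> obj (arrow1 (dg_complexes U))"
      using M Z z by (simp add: arrow1_def)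
    have ii: "?ii \<in> mor_deg (arrow1 (dg_complexes U)) ?P ?P 0"
      using z by (intro chain_id_arrow1 cM cZ) (simp add: closed0_def)
    have ii2: "?ii \<otimes>\<^bsub>grp (mor (arrow1 (dg_complexes U)) ?P ?P) 0\<^esub> ?ii
        \<in> mor_deg (arrow1 (dg_complexes U)) ?P ?P 0"
      using z zero_map_arrow1[OF cM cZ, of "zero_map M Z" U]
      by (simp add: mult_arrow1_0 chain_add_id_id two two_Z closed0_def)
    obtain A X B f g where FP: "fobj F ?P = (A, X, B, f, g)" by (metis prod_cases5)
    have "fobj (composition_functor (dg_complexes U)) (fobj F ?P) = ?P"
      using that(1) P by (simp add: enriched_functorial_factorization_def)
    \<comment> \<open>Being a section of composition fixes the two ends, so only the middle object
      \<open>X\<close> is unknown.\<close>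
    then have AB: "A = M" "B = Z" by (simp_all add: FP composition_functor_def)
    have dgF: "dg_functor (arrow1 (dg_complexes U)) (arrow2 (dg_complexes U)) F"
      using that(1) by (simp add: enriched_functorial_factorization_def)
    have X: "is_complex X"
      using dgF P FP by (fastforce simp: dg_functor_def arrow2_def complexes_def)
    have hom: "fmor F ?P ?P 0 \<in> hom (grp (mor (arrow1 (dg_complexes U)) ?P ?P) 0)
        (grp (mor (arrow2 (dg_complexes U)) (fobj F ?P) (fobj F ?P)) 0)"
      using dgF P unfolding dg_functor_def chain_maps_def ext_hom_def by blast
    have "fmor F ?P ?P 0 (ident (arrow1 (dg_complexes U)) ?P)
        = ident (arrow2 (dg_complexes U)) (fobj F ?P)"
      using dgF P unfolding dg_functor_def by blast
    then have id: "fmor F ?P ?P 0 ?ii = (chain_id A, chain_id X, chain_id B)"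
      by (simp add: FP arrow1_def arrow2_def)
    have "quasi_iso M X f" "fibration U X Z g"
      using fac P FP AB by (auto simp: factors_through_def)
    \<comment> \<open>The identity of the arrow is three times itself because both \<open>M\<close>
      and \<open>Z\<close> have exponent two. Applying \<open>F\<close> gives an equation of
      triples, whose middle component is the one for \<open>X\<close>.\<close>
    moreover have "chain_add X X (chain_id X) (chain_add X X (chain_id X) (chain_id X)) = chain_id X"
      using hom_cube[OF hom ii ii2]
      by (simp add: id FP mult_arrow1_0 mult_arrow2_0 cube chain_add_id_id chain_add_id_zero
          two_Z cZ)
    ultimately show False
      using no_qi[OF X] injective_if_fibration_to_zero[OF _ cZ zZ] by blast
  qed
  moreover have False if "enriched_fibrant_replacement U F" for F
  proof -
    let ?X = "fobj F M"
    obtain \<phi> where dgF: "dg_functor (dg_complexes U) (dg_complexes U) F"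
      and X: "fibrant U ?X" and q: "quasi_iso M ?X (\<phi> M)"
      using \<open>enriched_fibrant_replacement U F\<close> M unfolding enriched_fibrant_replacement_def by blast
    have cX: "is_complex ?X" using X by (simp add: fibrant_def complexes_def)
    \<comment> \<open>Fibrancy is applied to the zero map into \<open>Z\<close>; its kernel being
      all of \<open>?X\<close>, the components of \<open>?X\<close> are injective.\<close>
    have "fibration U ?X Z (zero_map ?X Z)"
      using X Z zZ zero_map_chain_maps[OF cX cZ] by (simp add: fibrant_def)
    moreover have hom: "fmor F M M 0 \<in> hom (grp (mor (dg_complexes U) M M) 0)
        (grp (mor (dg_complexes U) ?X ?X) 0)"
      using dgF M unfolding dg_functor_def chain_maps_def ext_hom_def by auto
    have "fmor F M M 0 (chain_id M) = chain_id ?X"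
      using dgF M unfolding dg_functor_def by simp
    then have "chain_add ?X ?X (chain_id ?X) (chain_add ?X ?X (chain_id ?X) (chain_id ?X))
        = chain_id ?X"
      using hom_cube[OF hom chain_id_cube_mor_deg_0(1)[OF cM two]] cube
        chain_id_cube_mor_deg_0(2)[OF cM two]
      by (simp add: mult_0_dg_complexes)
    ultimately show False
      using no_qi[OF cX] injective_if_fibration_to_zero[OF _ cZ zZ] q by blast
  qed
  ultimately show ?thesis
    unfolding admits_enriched_functorial_factorizations_def by blast
qed

end
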